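(* Let $G$ be a $3$-edge-connected cubic graph (multiple edges allowed) and let $A \subseteq V(G)$ be a set of vertices with $|\delta(A)| = 3$, where $\delta(A)$ is the set of edges with exactly one endpoint in $A$; write $\bar A = V(G)\setminus A$. Let $G_1 = G/A$ be the graph obtained by identifying all vertices of $A$ into a single new vertex $a$ (keeping multiple edges, deleting loops), and let $G_2 = G/\bar A$ be obtained by identifying all vertices of $\bar A$ into a single new vertex $\bar a$. The three edges incident with $a$ in $G_1$ and the three edges incident with $\bar a$ in $G_2$ are identified with the edges of $\delta(A)$ in the natural way. Suppose $M_1$ is a well-spread perfect matching of $G_1$ and $M_2$ is a well-spread perfect matching of $G_2$, and that $M_1$ and $M_2$ agree on $\delta(A)$ (i.e., they use the same edge of $\delta(A)$ under this identification). Then $M_1 \cup M_2$ (with the common edge of $\delta(A)$ counted once, as an edge of $G$) is a well-spread perfect matching of $G$.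
   Context: A perfect matching $M$ of a cubic (multi)graph $H$ is called well spread if every $3$-edge cut of $H$ contains exactly one edge of $M$. A $3$-edge cut is an edge cut consisting of exactly three edges; an edge cut is a set of edges whose removal increases the number of connected components. A graph is $k$-edge-connected if it remains connected whenever fewer than $k$ edges are removed. *)

theory Defs
  imports Main
begin

text \<open>
  Undirected multigraphs: every edge is mapped to the set of its end vertices, which has one
  element for a loop and two elements otherwise. Parallel edges are distinct edges with equal
  end sets.
\<close>

record ('v, 'e) mgraph =
  verts :: "'v set"
  edges :: "'e set"
  ends :: "'e \<Rightarrow> 'v set"

definition multigraph :: "('v, 'e) mgraph \<Rightarrow> bool" where
  "multigraph G \<longleftrightarrow> finite (verts G) \<and> finite (edges G) \<and>
     (\<forall>e\<in>edges G. ends G e \<subseteq> verts G \<and> card (ends G e) \<in> {1, 2})"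

text \<open>A loop contributes two to the degree of its end vertex.\<close>

definition degree :: "('v, 'e) mgraph \<Rightarrow> 'v \<Rightarrow> nat" where
  "degree G v = card {e \<in> edges G. v \<in> ends G e} + card {e \<in> edges G. ends G e = {v}}"

definition cubic :: "('v, 'e) mgraph \<Rightarrow> bool" where
  "cubic G \<longleftrightarrow> (\<forall>v\<in>verts G. degree G v = 3)"

definition adj :: "('v, 'e) mgraph \<Rightarrow> ('v \<times> 'v) set" where
  "adj G = {(u, v). \<exists>e\<in>edges G. ends G e = {u, v}}"

definition linked :: "('v, 'e) mgraph \<Rightarrow> ('v \<times> 'v) set" where
  "linked G = {(u, v). u \<in> verts G \<and> v \<in> verts G \<and> (u, v) \<in> (adj G)\<^sup>*}"

text \<open>Connected components are represented by their vertex sets.\<close>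

definition components :: "('v, 'e) mgraph \<Rightarrow> 'v set set" where
  "components G = verts G // linked G"

definition connected_graph :: "('v, 'e) mgraph \<Rightarrow> bool" where
  "connected_graph G \<longleftrightarrow> verts G \<noteq> {} \<and> (\<forall>u\<in>verts G. \<forall>v\<in>verts G. (u, v) \<in> linked G)"

definition delete_edges :: "('v, 'e) mgraph \<Rightarrow> 'e set \<Rightarrow> ('v, 'e) mgraph" where
  "delete_edges G F = G\<lparr>edges := edges G - F\<rparr>"

definition edge_connected :: "nat \<Rightarrow> ('v, 'e) mgraph \<Rightarrow> bool" where
  "edge_connected k G \<longleftrightarrow>
     (\<forall>F. F \<subseteq> edges G \<and> card F < k \<longrightarrow> connected_graph (delete_edges G F))"

definition edge_cut :: "('v, 'e) mgraph \<Rightarrow> 'e set \<Rightarrow> bool" where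
  "edge_cut G F \<longleftrightarrow>
     F \<subseteq> edges G \<and> card (components G) < card (components (delete_edges G F))"

text \<open>
  The edges with exactly one endpoint in \<open>A\<close>. Requiring an end outside \<open>A\<close> excludes loops
  at vertices of \<open>A\<close>.
\<close>

definition boundary :: "('v, 'e) mgraph \<Rightarrow> 'v set \<Rightarrow> 'e set" where
  "boundary G A = {e \<in> edges G. ends G e \<inter> A \<noteq> {} \<and> ends G e - A \<noteq> {}}"

text \<open>
  The graph \<open>G/A\<close>. The new vertex is \<^term>\<open>None\<close>, and a vertex \<open>v\<close> outside \<open>A\<close> becomes
  \<^term>\<open>Some v\<close>. Edges that are not deleted as loops keep their names, so the edges incident
  with the new vertex are literally the elements of \<open>boundary G A\<close>.
\<close>

definition contract_vertex :: "'v set \<Rightarrow> 'v \<Rightarrow> 'v option" where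
  "contract_vertex A v = (if v \<in> A then None else Some v)"

definition contract :: "('v, 'e) mgraph \<Rightarrow> 'v set \<Rightarrow> ('v option, 'e) mgraph" where
  "contract G A =
     \<lparr>verts = insert None (Some ` (verts G - A)),
      edges = {e \<in> edges G. card (contract_vertex A ` ends G e) \<noteq> 1},
      ends = (\<lambda>e. contract_vertex A ` ends G e)\<rparr>"

definition perfect_matching :: "('v, 'e) mgraph \<Rightarrow> 'e set \<Rightarrow> bool" where
  "perfect_matching G M \<longleftrightarrow>
     M \<subseteq> edges G \<and> (\<forall>e\<in>M. card (ends G e) = 2) \<and>
     (\<forall>v\<in>verts G. \<exists>!e. e \<in> M \<and> v \<in> ends G e)"

definition well_spread :: "('v, 'e) mgraph \<Rightarrow> 'e set \<Rightarrow> bool" where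
  "well_spread G M \<longleftrightarrow> (\<forall>F. edge_cut G F \<and> card F = 3 \<longrightarrow> card (M \<inter> F) = 1)"

end

theory Submission
  imports Defs
begin

text \<open>
  In a 3-edge-connected graph every 3-edge cut is the boundary of some vertex set \<open>X\<close>. If \<open>X\<close>
  and \<open>A\<close> crossed, then each of the four corners would have at least three boundary edges, and
  double counting gives corners of boundary exactly three with no diagonal edges; but then
  \<open>boundary G A\<close> splits into two parts of equal size, contradicting that three is odd. Hence \<open>X\<close> or
  its complement lies in \<open>A\<close> or in the complement of \<open>A\<close>, and the cut survives in one of the two
  contractions.
\<close>

section \<open>Counting edges between vertex sets\<close>

text \<open>For disjoint \<open>P\<close> and \<open>Q\<close> this is the usual E(P, Q); if they
  overlap, loops in the overlap are included too.\<close>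

definition between :: "('v, 'e) mgraph \<Rightarrow> 'v set \<Rightarrow> 'v set \<Rightarrow> 'e set" where
  "between G P Q = {e \<in> edges G. ends G e \<inter> P \<noteq> {} \<and> ends G e \<inter> Q \<noteq> {}}"

lemma between_commute: "between G P Q = between G Q P"
  by (auto simp: between_def)

lemma multigraph_ends_pair:
  assumes "multigraph G" "e \<in> edges G" "p \<in> ends G e" "q \<in> ends G e" "p \<noteq> q"
  shows "ends G e = {p, q}"
proof -
  have c: "card (ends G e) \<in> {1, 2}"
    using assms by (auto simp: multigraph_def)
  then have "finite (ends G e)"
    by (auto intro: card_ge_0_finite)
  moreover have "card (ends G e) \<le> card {p, q}"
    using c assms by auto
  ultimately show ?thesis
    using card_seteq[of "ends G e" "{p, q}"] assms by auto
qed

text \<open>An edge has at most two ends, so it cannot meet three pairwise disjoint sets; hence no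
  edge is counted twice on the right.\<close>

lemma card_between_Un:
  assumes "multigraph G" "P \<inter> Q = {}" "P \<inter> R = {}" "Q \<inter> R = {}"
  shows "card (between G P (Q \<union> R)) = card (between G P Q) + card (between G P R)"
proof -
  have "finite (edges G)"
    using assms(1) by (simp add: multigraph_def)
  moreover have "between G P Q \<inter> between G P R = {}"
  proof (rule ccontr)
    assume "between G P Q \<inter> between G P R \<noteq> {}"
    then obtain e p q r where e: "e \<in> edges G" "p \<in> ends G e" "p \<in> P" "q \<in> ends G e" "q \<in> Q"
      "r \<in> ends G e" "r \<in> R"
      by (auto simp: between_def)
    with assms have "p \<noteq> q"
      by blast
    then have "r \<in> {p, q}"
      using multigraph_ends_pair[OF assms(1) e(1,2,4)] e(6) by auto
    with e assms show False
      by blast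
  qed
  moreover have "between G P (Q \<union> R) = between G P Q \<union> between G P R"
    by (auto simp: between_def)
  ultimately show ?thesis
    by (simp add: card_Un_disjoint between_def)
qed

lemma boundary_eq_between:
  assumes "multigraph G"
  shows "boundary G X = between G X (verts G - X)"
  using assms unfolding boundary_def between_def multigraph_def by blast

lemma boundary_complement:
  assumes "multigraph G" "X \<subseteq> verts G"
  shows "boundary G (verts G - X) = boundary G X"
  using assms by (simp add: boundary_eq_between double_diff between_commute)

section \<open>Edge cuts and boundaries\<close>

text \<open>The first step of a walk out of \<open>X\<close> would use a boundary edge, and these
  are all deleted.\<close>

lemma boundary_separates:
  assumes "(u, v) \<in> (adj (delete_edges G (boundary G X)))\<^sup>*" "u \<in> X"
  shows "v \<in> X"
  using assms by (induction rule: rtrancl_induct) (auto simp: adj_def delete_edges_def boundary_def)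

lemma edge_connected_boundary:
  assumes "edge_connected k G" "u \<in> verts G" "u \<in> X" "v \<in> verts G" "v \<notin> X"
  shows "k \<le> card (boundary G X)"
proof (rule ccontr)
  assume "\<not> k \<le> card (boundary G X)"
  moreover have "boundary G X \<subseteq> edges G"
    by (auto simp: boundary_def)
  ultimately have "connected_graph (delete_edges G (boundary G X))"
    using assms(1) by (simp add: edge_connected_def)
  then have "(u, v) \<in> (adj (delete_edges G (boundary G X)))\<^sup>*"
    using assms by (auto simp: connected_graph_def linked_def delete_edges_def)
  with assms boundary_separates show False
    by metis
qed

lemma edge_connected_imp_connected:
  assumes "edge_connected k G" "0 < k"
  shows "connected_graph G"
proof -
  have "connected_graph (delete_edges G {})"
    using assms by (simp add: edge_connected_def)
  then show ?thesis
    by (simp add: delete_edges_def)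
qed

lemma card_components_connected:
  assumes "connected_graph G"
  shows "card (components G) = 1"
proof -
  have "linked G `` {u} = verts G" if "u \<in> verts G" for u
    using assms that by (auto simp: connected_graph_def linked_def)
  then have "components G = {verts G}"
    using assms by (auto simp: components_def quotient_def connected_graph_def)
  then show ?thesis
    by simp
qed

lemma edge_cut_boundary:
  assumes "finite (verts G)" "connected_graph G" "u \<in> verts G" "u \<in> X" "v \<in> verts G" "v \<notin> X"
  shows "edge_cut G (boundary G X)"
proof -
  let ?H = "delete_edges G (boundary G X)"
  have [simp]: "verts ?H = verts G"
    by (simp add: delete_edges_def)
  have "(u, v) \<notin> linked ?H" "(v, v) \<in> linked ?H"
    using assms boundary_separates[of u v G X] by (auto simp: linked_def)
  then have ne: "linked ?H `` {u} \<noteq> linked ?H `` {v}"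
    by blast
  have "{linked ?H `` {u}, linked ?H `` {v}} \<subseteq> components ?H"
    using assms by (auto simp: components_def intro: quotientI)
  \<comment> \<open>Finiteness matters: \<open>card\<close> of an infinite set defaults to
    0.\<close>
  moreover have "finite (components ?H)"
    using assms(1) by (simp add: components_def quotient_def)
  ultimately have "card {linked ?H `` {u}, linked ?H `` {v}} \<le> card (components ?H)"
    by (rule card_mono[rotated])
  with ne have "1 < card (components ?H)"
    by simp
  then show ?thesis
    using card_components_connected[OF assms(2)] by (auto simp: edge_cut_def boundary_def)
qed

text \<open>Deleting \<open>F\<close> disconnects the graph, and \<open>X\<close> is taken to be one
  resulting component. Only inclusion in \<open>F\<close> is claimed; edge-connectivity later turns
  it into equality for 3-edge cuts.\<close>

lemma edge_cut_contains_boundary: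
  assumes "multigraph G" "connected_graph G" "edge_cut G F"
  obtains X u v where "X \<subseteq> verts G" "u \<in> X" "v \<in> verts G" "v \<notin> X" "boundary G X \<subseteq> F"
proof -
  let ?H = "delete_edges G F"
  have [simp]: "verts ?H = verts G"
    by (simp add: delete_edges_def)
  have "\<not> connected_graph ?H"
    using assms card_components_connected[of G] card_components_connected[of ?H]
    by (auto simp: edge_cut_def)
  then obtain u v where uv: "u \<in> verts G" "v \<in> verts G" "(u, v) \<notin> linked ?H"
    using assms(2) by (auto simp: connected_graph_def)
  let ?X = "linked ?H `` {u}"
  \<comment> \<open>An edge leaving the component that survived the deletion would extend the
    component.\<close>
  have "boundary G ?X \<subseteq> F"
  proof
    fix e
    assume "e \<in> boundary G ?X"
    then obtain p q where e: "e \<in> edges G" "p \<in> ends G e" "q \<in> ends G e" "p \<in> ?X" "q \<notin> ?X"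
      by (auto simp: boundary_def)
    then have "ends G e = {p, q}"
      using multigraph_ends_pair[OF assms(1)] by metis
    moreover have "q \<in> verts G"
      using assms(1) e by (auto simp: multigraph_def)
    ultimately show "e \<in> F"
      using e by (auto simp: linked_def adj_def delete_edges_def dest: rtrancl_into_rtrancl)
  qed
  moreover have "?X \<subseteq> verts G" "u \<in> ?X"
    using uv by (auto simp: linked_def)
  ultimately show thesis
    using that uv by blast
qed

section \<open>Uncrossing two tight cuts\<close>

text \<open>Each of the four alternatives says that one of the corners \<open>X - A\<close>,
  \<open>A - X\<close>, \<open>A \<inter> X\<close>, \<open>verts G - (A \<union> X)\<close> is
  empty.\<close>

lemma tight_cuts_uncrossed:
  assumes G: "multigraph G" "edge_connected 3 G"
    and sub: "A \<subseteq> verts G" "X \<subseteq> verts G"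
    and tight: "card (boundary G A) = 3" "card (boundary G X) = 3"
  shows "X \<subseteq> A \<or> A \<subseteq> X \<or> X \<inter> A = {} \<or> X \<union> A = verts G"
proof (rule ccontr)
  assume crossing: "\<not> ?thesis"
  define P Q R S where "P = A \<inter> X" "Q = A - X" "R = X - A" "S = verts G - (A \<union> X)"
  note defs = this
  have ne: "P \<noteq> {}" "Q \<noteq> {}" "R \<noteq> {}" "S \<noteq> {}"
    using crossing sub by (auto simp: defs)
  have disj: "P \<inter> Q = {}" "P \<inter> R = {}" "P \<inter> S = {}" "Q \<inter> R = {}" "Q \<inter> S = {}" "R \<inter> S = {}"
    by (auto simp: defs)
  have V: "verts G = P \<union> Q \<union> R \<union> S" and A: "A = P \<union> Q" and X: "X = P \<union> R"
    using sub by (auto simp: defs)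
  have corner: "3 \<le> card (between G Y Z)" if "Y \<noteq> {}" "Z \<noteq> {}" "Y \<inter> Z = {}" "verts G = Y \<union> Z" for Y Z
  proof -
    from that obtain y z where "y \<in> Y" "z \<in> Z"
      by blast
    then have "3 \<le> card (boundary G Y)"
      using that by (intro edge_connected_boundary[OF G(2), of y Y z]) auto
    moreover have "verts G - Y = Z"
      using that by auto
    ultimately show ?thesis
      by (simp add: boundary_eq_between[OF G(1)])
  qed
  note split = card_between_Un[OF G(1)]
  let ?c = "\<lambda>Y Z. card (between G Y Z)"
  \<comment> \<open>\<open>three\<close> expands the boundary of a single corner,
    \<open>four\<close> that of a union of two corners. All conditions become linear in the six edge
    counts between pairs of corners.\<close>
  have three: "?c Y (Z \<union> (U \<union> W)) = ?c Y Z + ?c Y U + ?c Y W"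
    if "Y \<inter> Z = {}" "Y \<inter> U = {}" "Y \<inter> W = {}" "Z \<inter> U = {}" "Z \<inter> W = {}" "U \<inter> W = {}" for Y Z U W
    using that split[of Y Z "U \<union> W"] split[of Y U W] by (simp add: Int_Un_distrib)
  have four: "?c (Y \<union> Z) (U \<union> W) = ?c Y U + ?c Y W + ?c Z U + ?c Z W"
    if "Y \<inter> Z = {}" "Y \<inter> U = {}" "Y \<inter> W = {}" "Z \<inter> U = {}" "Z \<inter> W = {}" "U \<inter> W = {}" for Y Z U W
    using that split[of "Y \<union> Z" U W] split[of U Y Z] split[of W Y Z]
    by (simp add: Int_Un_distrib Int_Un_distrib2 Int_commute between_commute)
  have "3 \<le> ?c P Q + ?c P R + ?c P S"
    using corner[of P "Q \<union> (R \<union> S)"] three[of P Q R S] ne disj V by (simp add: Int_Un_distrib Un_ac)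
  moreover have "3 \<le> ?c P Q + ?c Q R + ?c Q S"
    using corner[of Q "P \<union> (R \<union> S)"] three[of Q P R S] ne disj V
    by (simp add: Int_Un_distrib Un_ac Int_commute between_commute)
  moreover have "3 \<le> ?c P R + ?c Q R + ?c R S"
    using corner[of R "P \<union> (Q \<union> S)"] three[of R P Q S] ne disj V
    by (simp add: Int_Un_distrib Un_ac Int_commute between_commute)
  moreover have "3 \<le> ?c P S + ?c Q S + ?c R S"
    using corner[of S "P \<union> (Q \<union> R)"] three[of S P Q R] ne disj V
    by (simp add: Int_Un_distrib Un_ac Int_commute between_commute)
  moreover have "?c P R + ?c P S + ?c Q R + ?c Q S = 3"
  proof -
    have "verts G - A = R \<union> S"
      using disj V A by auto
    then show ?thesis
      using tight(1) four[of P Q R S] disj by (simp add: boundary_eq_between[OF G(1)] A)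
  qed
  moreover have "?c P Q + ?c P S + ?c Q R + ?c R S = 3"
  proof -
    have "verts G - X = Q \<union> S"
      using disj V X by auto
    then show ?thesis
      using tight(2) four[of P R Q S] disj
      by (simp add: boundary_eq_between[OF G(1)] X Int_commute between_commute)
  qed
  \<comment> \<open>The boundary sizes of \<open>P\<close> and \<open>S\<close> add up to 6 - 2
    \<open>?c Q R\<close> and are at least 6, so \<open>?c Q R\<close> is 0; the pair
    \<open>Q\<close>, \<open>R\<close> gives \<open>?c P S\<close> = 0 likewise. All corner
    boundaries are then exactly 3, and comparing \<open>P\<close> with \<open>Q\<close> gives the
    second equation.\<close>
  ultimately have "?c P R + ?c Q S = 3" "?c P R = ?c Q S"
    by linarith+
  then show False
    by presburger
qed

section \<open>Contractions\<close>

text \<open>Walks project to the contraction. \<open>B\<close> must be nonempty, since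
  \<open>contract\<close> always adds \<open>None\<close>, which would otherwise be
  isolated.\<close>

lemma connected_contract:
  assumes "connected_graph G" "B \<subseteq> verts G" "B \<noteq> {}"
  shows "connected_graph (contract G B)"
proof -
  let ?c = "contract_vertex B"
  have path: "(?c u, ?c v) \<in> (adj (contract G B))\<^sup>*" if "(u, v) \<in> (adj G)\<^sup>*" for u v
    using that
  proof (induction rule: rtrancl_induct)
    case (step v w)
    then obtain e where e: "e \<in> edges G" "ends G e = {v, w}"
      by (auto simp: adj_def)
    show ?case
    \<comment> \<open>If both ends are identified, the edge is deleted as a loop and the projected
      walk just stays in place.\<close>
    proof (cases "?c v = ?c w")
      case False
      then have "(?c v, ?c w) \<in> adj (contract G B)"
        using e by (auto simp: adj_def contract_def)
      with step.IH show ?thesis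
        by (rule rtrancl_into_rtrancl)
    qed (use step.IH in simp)
  qed simp
  have "verts (contract G B) = ?c ` verts G"
    using assms(2,3) by (auto simp: contract_def contract_vertex_def)
  then show ?thesis
    using assms(1) path by (auto simp: connected_graph_def linked_def)
qed

text \<open>A boundary edge of \<open>X\<close> has one end in \<open>X\<close> and one outside, and
  these stay distinct after contracting a set that avoids \<open>X\<close>; so the edge is not
  deleted, and it keeps its name.\<close>

lemma boundary_contract:
  assumes "X \<inter> B = {}"
  shows "boundary (contract G B) (Some ` X) = boundary G X"
proof -
  let ?c = "contract_vertex B"
  \<comment> \<open>The preimage of the copy of \<open>X\<close> is exactly \<open>X\<close>, so
    both tests in the definition of \<open>boundary\<close> transfer.\<close>
  have mem: "?c v \<in> Some ` X \<longleftrightarrow> v \<in> X" for v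
    using assms by (auto simp: contract_vertex_def)
  have "card (?c ` ends G e) \<noteq> 1" if e: "p \<in> ends G e" "p \<in> X" "q \<in> ends G e" "q \<notin> X" for e p q
  proof
    assume "card (?c ` ends G e) = 1"
    then obtain w where "?c ` ends G e = {w}"
      by (auto simp: card_1_singleton_iff)
    with e have "?c p = ?c q"
      by (metis imageI singletonD)
    with e mem[of p] mem[of q] show False
      by simp
  qed
  then have proper: "card (?c ` ends G e) \<noteq> 1" if "ends G e \<inter> X \<noteq> {}" "ends G e - X \<noteq> {}" for e
    using that by blast
  have iffs: "?c ` E \<inter> Some ` X \<noteq> {} \<longleftrightarrow> E \<inter> X \<noteq> {}"
    "?c ` E - Some ` X \<noteq> {} \<longleftrightarrow> E - X \<noteq> {}" for E
  proof -
    have "?c ` E \<inter> T = ?c ` {v \<in> E. ?c v \<in> T}" "?c ` E - T = ?c ` {v \<in> E. ?c v \<notin> T}" for T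
      by blast+
    then have "?c ` E \<inter> Some ` X = ?c ` (E \<inter> X)" "?c ` E - Some ` X = ?c ` (E - X)"
      by (simp_all only: mem Int_def set_diff_eq mem_Collect_eq)
    then show "?c ` E \<inter> Some ` X \<noteq> {} \<longleftrightarrow> E \<inter> X \<noteq> {}"
      "?c ` E - Some ` X \<noteq> {} \<longleftrightarrow> E - X \<noteq> {}"
      by simp_all
  qed
  show ?thesis
    unfolding boundary_def contract_def mgraph.select_convs iffs mem_Collect_eq
    using proper by blast
qed

text \<open>An edge that reaches \<open>B\<close> becomes a loop at \<open>None\<close> precisely
  when all its ends lie in \<open>B\<close>. This forces a matching edge of one contraction that
  reaches the contracted side into the boundary, where the two matchings agree.\<close>

lemma edges_contract_iff:
  assumes "multigraph G" "B \<subseteq> verts G" "v \<in> B" "v \<in> ends G e"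
  shows "e \<in> edges (contract G B) \<longleftrightarrow> e \<in> boundary G B"
proof (cases "ends G e \<subseteq> B")
  case True
  then have "contract_vertex B ` ends G e = {None}"
    using assms by (auto simp: contract_vertex_def)
  then show ?thesis
    using True by (auto simp: contract_def boundary_def)
next
  case False
  then obtain q where q: "q \<in> ends G e" "q \<notin> B"
    by blast
  have "card (contract_vertex B ` ends G e) \<noteq> 1"
  proof
    assume "card (contract_vertex B ` ends G e) = 1"
    then obtain w where "contract_vertex B ` ends G e = {w}"
      by (auto simp: card_1_singleton_iff)
    then have "contract_vertex B v = contract_vertex B q"
      using assms q by (metis imageI singletonD)
    then show False
      using assms q by (simp add: contract_vertex_def)
  qed
  then show ?thesis
    using False assms by (auto simp: contract_def boundary_def)
qed

section \<open>Gluing the matchings\<close>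

text \<open>Edges of \<open>N\<close> that touch \<open>X\<close> lie in the boundary of
  \<open>B\<close>, hence belong to \<open>M\<close>. So on the cut \<open>M \<union> N\<close> is
  just \<open>M\<close>, and the cut is a 3-edge cut of the contraction. The set \<open>B\<close> is
  kept general so that it can be either side of the given cut.\<close>

lemma glued_cut_inside:
  assumes G: "multigraph G" "connected_graph G" and B: "B \<subseteq> verts G" "B \<noteq> {}"
    and spread: "well_spread (contract G B) M"
    and N: "N \<subseteq> edges (contract G (verts G - B))"
    and agree: "N \<inter> boundary G B = M \<inter> boundary G B"
    and X: "X \<subseteq> verts G - B" "X \<noteq> {}" "card (boundary G X) = 3"
  shows "card ((M \<union> N) \<inter> boundary G X) = 1"
proof -
  have "N \<inter> boundary G X \<subseteq> boundary G (verts G - B)"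
  proof
    fix e
    assume e: "e \<in> N \<inter> boundary G X"
    then obtain v where "v \<in> ends G e" "v \<in> X"
      by (auto simp: boundary_def)
    with e N X edges_contract_iff[OF G(1), of "verts G - B" v e]
    show "e \<in> boundary G (verts G - B)"
      by auto
  qed
  then have "(M \<union> N) \<inter> boundary G X = M \<inter> boundary G X"
    using agree boundary_complement[OF G(1) B(1)] by auto
  moreover have "edge_cut (contract G B) (boundary G X)"
  proof -
    obtain x where "x \<in> X"
      using X by blast
    \<comment> \<open>The new vertex \<open>None\<close> witnesses that the copy of \<open>X\<close>
      is a proper subset of the vertices.\<close>
    then have "edge_cut (contract G B) (boundary (contract G B) (Some ` X))"
      using X G by (intro edge_cut_boundary[where u = "Some x" and v = None] connected_contract B)
        (auto simp: contract_def multigraph_def)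
    moreover have "X \<inter> B = {}"
      using X by blast
    ultimately show ?thesis
      by (simp add: boundary_contract)
  qed
  ultimately show ?thesis
    using spread X(3) by (simp add: well_spread_def)
qed

lemma card_ends_contract_edge:
  assumes "multigraph G" "e \<in> edges (contract G B)"
  shows "card (ends G e) = 2"
proof -
  have "card (ends G e) \<in> {1, 2}" "card (contract_vertex B ` ends G e) \<noteq> 1"
    using assms by (auto simp: contract_def multigraph_def)
  then show ?thesis
    by (auto simp: card_1_singleton_iff)
qed

text \<open>An edge of \<open>N\<close> at \<open>v\<close> lies in the boundary of \<open>B\<close>
  and so already belongs to \<open>M\<close>; existence and uniqueness are inherited from
  \<open>M\<close> at \<open>Some v\<close>.\<close>

lemma glued_matching_covers:
  assumes G: "multigraph G" and B: "B \<subseteq> verts G"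
    and M: "perfect_matching (contract G B) M"
    and N: "N \<subseteq> edges (contract G (verts G - B))"
    and agree: "N \<inter> boundary G B = M \<inter> boundary G B"
    and v: "v \<in> verts G - B"
  shows "\<exists>!e. e \<in> M \<union> N \<and> v \<in> ends G e"
proof -
  have N_sub: "e \<in> M" if "e \<in> N" "v \<in> ends G e" for e
    using that N v agree edges_contract_iff[OF G, of "verts G - B" v e] boundary_complement[OF G B]
    by auto
  have "\<exists>!e. e \<in> M \<and> Some v \<in> ends (contract G B) e"
    using M v by (auto simp: perfect_matching_def contract_def)
  moreover have "Some v \<in> ends (contract G B) e \<longleftrightarrow> v \<in> ends G e" for e
    using v by (auto simp: contract_def contract_vertex_def image_iff)
  ultimately show ?thesis
    using N_sub by (metis Un_iff)
qed

theorem theorem2: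
  fixes G :: "('v, 'e) mgraph" and A :: "'v set" and M1 M2 :: "'e set"
  assumes "multigraph G" and "cubic G" and "edge_connected 3 G"
    and "A \<subseteq> verts G" and "card (boundary G A) = 3"
    and "perfect_matching (contract G A) M1" and "well_spread (contract G A) M1"
    and "perfect_matching (contract G (verts G - A)) M2"
    and "well_spread (contract G (verts G - A)) M2"
    and "M1 \<inter> boundary G A = M2 \<inter> boundary G A"
  shows "perfect_matching G (M1 \<union> M2) \<and> well_spread G (M1 \<union> M2)"
proof
  let ?B = "verts G - A"
  have comp: "verts G - ?B = A" "boundary G ?B = boundary G A"
    using assms(1,4) by (auto simp: boundary_complement)
  have edges: "M1 \<subseteq> edges (contract G A)" "M2 \<subseteq> edges (contract G ?B)"
    using assms(6,8) by (auto simp: perfect_matching_def)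
  show "perfect_matching G (M1 \<union> M2)"
    unfolding perfect_matching_def
  proof (intro conjI ballI)
    show "M1 \<union> M2 \<subseteq> edges G"
      using edges by (auto simp: contract_def)
    show "card (ends G e) = 2" if "e \<in> M1 \<union> M2" for e
      using that edges card_ends_contract_edge[OF assms(1)] by blast
    show "\<exists>!e. e \<in> M1 \<union> M2 \<and> v \<in> ends G e" if v: "v \<in> verts G" for v
    \<comment> \<open>A vertex survives in the contraction of the side not containing it; for
      \<open>v\<close> in \<open>A\<close> the roles of \<open>M1\<close> and \<open>M2\<close> are
      therefore swapped.\<close>
    proof (cases "v \<in> A")
      case True
      then show ?thesis
        using glued_matching_covers[OF assms(1) _ assms(8), of M1 v] v edges assms(10)
        by (simp add: comp Un_commute)
    next
      case False
      then show ?thesis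
        using glued_matching_covers[OF assms(1,4,6), of M2 v] v edges assms(10) by simp
    qed
  qed
  have conn: "connected_graph G"
    using edge_connected_imp_connected[OF assms(3)] by simp
  \<comment> \<open>Having three boundary edges, the cut has two nonempty sides.\<close>
  have "between G A ?B \<noteq> {}"
    using assms(5) boundary_eq_between[OF assms(1), of A] by auto
  then have ne: "A \<noteq> {}" "?B \<noteq> {}"
    unfolding between_def by blast+
  have in_B: "card ((M1 \<union> M2) \<inter> boundary G X) = 1"
    if "X \<subseteq> ?B" "X \<noteq> {}" "card (boundary G X) = 3" for X
    by (rule glued_cut_inside[OF assms(1) conn assms(4) ne(1) assms(7) edges(2) _ that])
      (simp add: assms(10))
  have "card ((M2 \<union> M1) \<inter> boundary G X) = 1"
    if X: "X \<subseteq> A" "X \<noteq> {}" "card (boundary G X) = 3" for X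
    by (rule glued_cut_inside[OF assms(1) conn _ ne(2) assms(9)])
      (use X edges assms(10) in \<open>simp_all add: comp\<close>)
  then have in_A: "card ((M1 \<union> M2) \<inter> boundary G X) = 1"
    if "X \<subseteq> A" "X \<noteq> {}" "card (boundary G X) = 3" for X
    using that by (simp add: Un_commute)
  show "well_spread G (M1 \<union> M2)"
    unfolding well_spread_def
  proof (intro allI impI)
    fix F
    assume F: "edge_cut G F \<and> card F = 3"
    then obtain X u v where X: "X \<subseteq> verts G" "u \<in> X" "v \<in> verts G" "v \<notin> X" "boundary G X \<subseteq> F"
      using edge_cut_contains_boundary[OF assms(1) conn, of F] by blast
    \<comment> \<open>The boundary sits inside the three-element set \<open>F\<close>, so this lower
      bound makes them equal.\<close>
    have "3 \<le> card (boundary G X)"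
      using edge_connected_boundary[OF assms(3)] X by blast
    then have F_eq: "boundary G X = F"
      using F X(5) by (intro card_seteq) (auto intro: card_ge_0_finite)
    let ?Y = "verts G - X"
    have Y: "boundary G ?Y = F" "X \<noteq> {}" "?Y \<noteq> {}"
      using F_eq boundary_complement[OF assms(1) X(1)] X by auto
    have "X \<subseteq> A \<or> A \<subseteq> X \<or> X \<inter> A = {} \<or> X \<union> A = verts G"
      using tight_cuts_uncrossed[OF assms(1,3,4) X(1) assms(5)] F F_eq by simp
    \<comment> \<open>\<open>A \<subseteq> X\<close> and \<open>X \<union> A = verts G\<close> are
      restated for the complement of \<open>X\<close>, which has the same boundary; in every case a
      set with boundary \<open>F\<close> lies in one side.\<close>
    then consider "X \<subseteq> A" | "?Y \<subseteq> ?B" | "X \<subseteq> ?B" | "?Y \<subseteq> A"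
      using X(1) by blast
    then show "card ((M1 \<union> M2) \<inter> F) = 1"
      using in_A[of X] in_A[of ?Y] in_B[of X] in_B[of ?Y] F F_eq Y by cases simp_all
  qed
qed

end
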